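(* Let $a$ be a positive odd integer, let $m$ be a nonnegative integer and let $n$ be a positive integer. If $n\equiv m+\frac{a-1}2\pmod 2$, then $$t(a,3a,8m+4,8m+4;n)=\frac 23N(a,3a,8m+4,8m+4;8n+16m+4a+8)-2N(a,3a,8m+4,8m+4;2n+4m+a+2).$$
   Context: For positive integers $a,b,c,d$ and a nonnegative integer $n$, $N(a,b,c,d;n)$ denotes the number of $(x,y,z,w)\in\mathbb Z^4$ with $n=ax^2+by^2+cz^2+dw^2$, and $t(a,b,c,d;n)$ denotes the number of $(x,y,z,w)\in\mathbb Z^4$ with $n=a\frac{x(x-1)}2+b\frac{y(y-1)}2+c\frac{z(z-1)}2+d\frac{w(w-1)}2$. *)

theory Defs
  imports Complex_Main "HOL-Number_Theory.Cong"
begin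

(* For positive a, b, c, d the solution sets below are finite, so card counts them;
   for other parameters card may return 0 on an infinite set. *)

definition N_rep :: "nat \<Rightarrow> nat \<Rightarrow> nat \<Rightarrow> nat \<Rightarrow> nat \<Rightarrow> nat" where
  "N_rep a b c d n =
     card {(x :: int, y :: int, z :: int, w :: int).
       int n = int a * x\<^sup>2 + int b * y\<^sup>2 + int c * z\<^sup>2 + int d * w\<^sup>2}"

(* The product x * (x - 1) is always even, so each div 2 is exact. *)

definition t_rep :: "nat \<Rightarrow> nat \<Rightarrow> nat \<Rightarrow> nat \<Rightarrow> nat \<Rightarrow> nat" where
  "t_rep a b c d n =
     card {(x :: int, y :: int, z :: int, w :: int).
       int n = int a * (x * (x - 1) div 2) + int b * (y * (y - 1) div 2)
             + int c * (z * (z - 1) div 2) + int d * (w * (w - 1) div 2)}"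

end

theory Submission
  imports Defs
begin

text \<open>
  Put \<open>C = 2m + 1\<close>, \<open>K = 2n + 4m + a + 2\<close>, and let \<open>S\<close> be the solution set of
  \<open>a (u\<^sup>2 + 3 v\<^sup>2) + C (z\<^sup>2 + w\<^sup>2) = K\<close>. The congruence on \<open>n\<close> says \<open>K \<equiv> - C (mod 4)\<close>, which
  forces \<open>u + v\<close> odd and \<open>z \<equiv> w (mod 2)\<close> on \<open>S\<close>. If \<open>x\<^sup>2 + 3 y\<^sup>2 = 4 s\<close>, then up to the units
  of the Eisenstein integers \<open>(x, y)\<close> is twice a solution \<open>(u, v)\<close> of \<open>u\<^sup>2 + 3 v\<^sup>2 = s\<close>: it is
  \<open>(2 u, 2 v)\<close>, \<open>(u + 3 v, v - u)\<close> or \<open>(u + 3 v, u - v)\<close>. For odd \<open>s\<close> these three cases are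
  disjoint, and the last two are those with \<open>x\<close>, \<open>y\<close> odd. Hence \<open>N(4K) = 3 |S|\<close>. Completing
  squares, \<open>t(n)\<close> counts the solutions for \<open>4K\<close> with all entries odd, so \<open>t(n)\<close> is twice the
  number of elements of \<open>S\<close> with \<open>z\<close>, \<open>w\<close> odd; those with \<open>z\<close>, \<open>w\<close> even number \<open>N(K)\<close>.
\<close>

definition diag_sols :: "int \<Rightarrow> int \<Rightarrow> int \<Rightarrow> int \<Rightarrow> int \<Rightarrow> (int \<times> int \<times> int \<times> int) set" where
  "diag_sols a b c d k = {(x, y, z, w). k = a * x\<^sup>2 + b * y\<^sup>2 + c * z\<^sup>2 + d * w\<^sup>2}"

lemma mem_diag_sols [simp]:
  "(x, y, z, w) \<in> diag_sols a b c d k \<longleftrightarrow> k = a * x\<^sup>2 + b * y\<^sup>2 + c * z\<^sup>2 + d * w\<^sup>2"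
  by (simp add: diag_sols_def)

lemma N_rep_eq_card_diag_sols: "N_rep a b c d n = card (diag_sols a b c d n)"
  by (simp add: N_rep_def diag_sols_def)

text \<open>An integer is at most its square in absolute value, so every coordinate is bounded by
  \<open>k\<close>. Finiteness lets \<open>card\<close> be added over disjoint unions.\<close>

lemma finite_diag_sols:
  assumes "a > 0" "b > 0" "c > 0" "d > 0"
  shows "finite (diag_sols a b c d k)"
proof (rule finite_subset)
  have le: "\<bar>x\<bar> \<le> e * x\<^sup>2" if "e > 0" for e x :: int
  proof -
    have "\<bar>x\<bar> * 1 \<le> \<bar>x\<bar> * \<bar>x\<bar>"
      by (cases "x = 0") (auto intro!: mult_left_mono simp del: abs_mult_self_eq)
    also have "\<dots> = 1 * x\<^sup>2"
      by (simp add: power2_eq_square)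
    also have "\<dots> \<le> e * x\<^sup>2"
      using that by (intro mult_right_mono) auto
    finally show ?thesis by simp
  qed
  show "diag_sols a b c d k \<subseteq> {-k..k} \<times> {-k..k} \<times> {-k..k} \<times> {-k..k}"
  proof
    fix q assume q: "q \<in> diag_sols a b c d k"
    obtain x y z w where xyzw: "q = (x, y, z, w)" by (cases q)
    from q have "k = a * x\<^sup>2 + b * y\<^sup>2 + c * z\<^sup>2 + d * w\<^sup>2"
      by (simp add: xyzw)
    with le[OF assms(1), of x] le[OF assms(2), of y] le[OF assms(3), of z] le[OF assms(4), of w]
    show "q \<in> {-k..k} \<times> {-k..k} \<times> {-k..k} \<times> {-k..k}"
      by (auto simp: xyzw)
  qed
qed auto

definition all_odd :: "(int \<times> int \<times> int \<times> int) set" where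
  "all_odd = {(x, y, z, w). odd x \<and> odd y \<and> odd z \<and> odd w}"

lemma mem_all_odd [simp]: "(x, y, z, w) \<in> all_odd \<longleftrightarrow> odd x \<and> odd y \<and> odd z \<and> odd w"
  by (simp add: all_odd_def)

lemma eight_triangular: "8 * (x * (x - 1) div 2) = (2 * x - 1)\<^sup>2 - (1 :: int)"
proof -
  have "even (x * (x - 1))" by auto
  then have "8 * (x * (x - 1) div 2) = 4 * (x * (x - 1))"
    by (elim evenE) simp
  also have "\<dots> = (2 * x - 1)\<^sup>2 - 1"
    by (simp add: power2_eq_square algebra_simps)
  finally show ?thesis .
qed

text \<open>Multiply the equation by 8 and complete the squares; \<open>x\<close> to
  \<open>2 * x - 1\<close> maps the integers bijectively onto the odd ones.\<close>

lemma t_rep_eq_card_odd_diag_sols: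
  "t_rep a b c d n = card (diag_sols a b c d (8 * n + a + b + c + d) \<inter> all_odd)"
proof -
  define h :: "int \<times> int \<times> int \<times> int \<Rightarrow> int \<times> int \<times> int \<times> int"
    where "h = (\<lambda>(x, y, z, w). (2 * x - 1, 2 * y - 1, 2 * z - 1, 2 * w - 1))"
  define A where "A = {(x, y, z, w).
       int n = int a * (x * (x - 1) div 2) + int b * (y * (y - 1) div 2)
             + int c * (z * (z - 1) div 2) + int d * (w * (w - 1) div 2)}"
  have mem: "q \<in> A \<longleftrightarrow> h q \<in> diag_sols a b c d (8 * n + a + b + c + d)" for q
  proof -
    obtain x y z w where q: "q = (x, y, z, w)" by (cases q)
    let ?t = "\<lambda>x. x * (x - 1) div (2 :: int)"
    have sq: "(2 * x - 1)\<^sup>2 = 8 * ?t x + 1" for x :: int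
      using eight_triangular[of x] by simp
    have "q \<in> A \<longleftrightarrow> 8 * int n = 8 * (a * ?t x + b * ?t y + c * ?t z + d * ?t w)"
      by (simp only: mult_cancel_left) (simp add: A_def q)
    also have "\<dots> \<longleftrightarrow> h q \<in> diag_sols a b c d (8 * n + a + b + c + d)"
      unfolding q h_def prod.case mem_diag_sols sq distrib_left mult_1_right
        mult.left_commute[of _ 8] by linarith
    finally show ?thesis .
  qed
  have "h ` A = diag_sols a b c d (8 * n + a + b + c + d) \<inter> all_odd"
  proof (intro equalityI subsetI)
    fix p assume "p \<in> h ` A"
    then show "p \<in> diag_sols a b c d (8 * n + a + b + c + d) \<inter> all_odd"
      using mem by (auto simp: h_def)
  next
    fix p assume p: "p \<in> diag_sols a b c d (8 * n + a + b + c + d) \<inter> all_odd"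
    obtain x y z w where xyzw: "p = (x, y, z, w)" by (cases p)
    define q where "q = ((x + 1) div 2, (y + 1) div 2, (z + 1) div 2, (w + 1) div 2)"
    have "h q = p" using p by (auto simp: xyzw h_def q_def elim!: oddE)
    then show "p \<in> h ` A" using mem[of q] p by auto
  qed
  moreover have "inj_on h A" by (auto simp: inj_on_def h_def)
  ultimately show ?thesis
    unfolding t_rep_def A_def[symmetric] by (metis card_image)
qed

text \<open>Multiplication of \<open>u + v \<surd>-3\<close> by \<open>2\<close>, \<open>1 - \<surd>-3\<close>, and the latter followed by conjugation.\<close>

definition scale2 :: "int \<times> int \<times> int \<times> int \<Rightarrow> int \<times> int \<times> int \<times> int" where
  "scale2 = (\<lambda>(u, v, z, w). (2 * u, 2 * v, z, w))"

definition rot :: "int \<times> int \<times> int \<times> int \<Rightarrow> int \<times> int \<times> int \<times> int" where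
  "rot = (\<lambda>(u, v, z, w). (u + 3 * v, v - u, z, w))"

definition rot_conj :: "int \<times> int \<times> int \<times> int \<Rightarrow> int \<times> int \<times> int \<times> int" where
  "rot_conj = (\<lambda>(u, v, z, w). (u + 3 * v, u - v, z, w))"

lemma inj_scale2: "inj_on scale2 A"
  by (auto simp: inj_on_def scale2_def)

lemma inj_rot: "inj_on rot A"
  by (auto simp: inj_on_def rot_def)

lemma inj_rot_conj: "inj_on rot_conj A"
  by (auto simp: inj_on_def rot_conj_def)

text \<open>The norm \<open>u\<^sup>2 + 3 * v\<^sup>2\<close> is multiplicative and invariant under
  conjugation, and both multipliers have norm 4.\<close>

lemma scale_rot_mem_iff:
  "scale2 p \<in> diag_sols a (3 * a) (4 * c) (4 * c) (4 * k) \<longleftrightarrow> p \<in> diag_sols a (3 * a) c c k"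
  "rot p \<in> diag_sols a (3 * a) (4 * c) (4 * c) (4 * k) \<longleftrightarrow> p \<in> diag_sols a (3 * a) c c k"
  "rot_conj p \<in> diag_sols a (3 * a) (4 * c) (4 * c) (4 * k) \<longleftrightarrow> p \<in> diag_sols a (3 * a) c c k"
proof -
  obtain u v z w where p: "p = (u, v, z, w)" by (cases p)
  have *: "k = r \<longleftrightarrow> 4 * k = 4 * r" for r by simp
  show "scale2 p \<in> diag_sols a (3 * a) (4 * c) (4 * c) (4 * k) \<longleftrightarrow> p \<in> diag_sols a (3 * a) c c k"
    unfolding p scale2_def prod.case mem_diag_sols *[of "a * _ + _ + _ + _"]
    by (simp add: power_mult_distrib distrib_left ac_simps del: mult_cancel_left)
  show "rot p \<in> diag_sols a (3 * a) (4 * c) (4 * c) (4 * k) \<longleftrightarrow> p \<in> diag_sols a (3 * a) c c k"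
    unfolding p rot_def prod.case mem_diag_sols *[of "a * _ + _ + _ + _"]
    by (simp add: power2_eq_square algebra_simps)
  show "rot_conj p \<in> diag_sols a (3 * a) (4 * c) (4 * c) (4 * k) \<longleftrightarrow> p \<in> diag_sols a (3 * a) c c k"
    unfolding p rot_conj_def prod.case mem_diag_sols *[of "a * _ + _ + _ + _"]
    by (simp add: power2_eq_square algebra_simps)
qed

lemma odd_pair_preimage:
  assumes "odd x" "odd y"
  obtains p where "rot p = (x, y, z, w)" | p where "rot_conj p = (x, y, z, w)"
proof -
  \<comment> \<open>Both numbers are even and their sum \<open>2 * x\<close> is 2 modulo 4. The two
    cases invert \<open>rot\<close> and \<open>rot_conj\<close> respectively.\<close>
  have "4 dvd x + y \<or> 4 dvd x - y"
    using assms by presburger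
  then show thesis
  proof
    assume "4 dvd x + y"
    then obtain v where "x + y = 4 * v" ..
    then have "rot (v - y, v, z, w) = (x, y, z, w)" by (simp add: rot_def)
    then show thesis by (rule that)
  next
    assume "4 dvd x - y"
    then obtain v where "x - y = 4 * v" ..
    then have "rot_conj (v + y, v, z, w) = (x, y, z, w)" by (simp add: rot_conj_def)
    then show thesis by (rule that)
  qed
qed

lemma diag_sols_times_four:
  assumes "odd a"
  shows "diag_sols a (3 * a) (4 * c) (4 * c) (4 * k) =
    scale2 ` diag_sols a (3 * a) c c k \<union>
    (rot ` diag_sols a (3 * a) c c k \<union> rot_conj ` diag_sols a (3 * a) c c k)"
    (is "?Q = scale2 ` ?S \<union> (rot ` ?S \<union> rot_conj ` ?S)")
proof (intro equalityI subsetI)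
  fix q assume q: "q \<in> ?Q"
  obtain x y z w where xyzw: "q = (x, y, z, w)" by (cases q)
  from q have eq: "4 * k = a * x\<^sup>2 + 3 * a * y\<^sup>2 + 4 * c * z\<^sup>2 + 4 * c * w\<^sup>2"
    by (simp add: xyzw)
  \<comment> \<open>As \<open>a\<close> is odd, this sum is congruent to \<open>x + y\<close> modulo
    2.\<close>
  have "even (a * x\<^sup>2 + 3 * a * y\<^sup>2 + 4 * c * z\<^sup>2 + 4 * c * w\<^sup>2)"
    by (simp flip: eq)
  then have par: "even x \<longleftrightarrow> even y"
    using assms by auto
  have "\<exists>p. q = scale2 p \<or> q = rot p \<or> q = rot_conj p"
  proof (cases "even x")
    case True
    then have "q = scale2 (x div 2, y div 2, z, w)"
      using par by (simp add: xyzw scale2_def)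
    then show ?thesis by blast
  next
    case False
    with par show ?thesis
      unfolding xyzw by (metis odd_pair_preimage)
  qed
  then show "q \<in> scale2 ` ?S \<union> (rot ` ?S \<union> rot_conj ` ?S)"
    using q scale_rot_mem_iff by blast
next
  fix q assume "q \<in> scale2 ` ?S \<union> (rot ` ?S \<union> rot_conj ` ?S)"
  then show "q \<in> ?Q"
    using scale_rot_mem_iff by blast
qed

text \<open>At a common value, subtracting the second coordinate from the first gives
  \<open>2 * (u + v) = 4 * v'\<close>, so \<open>u + v\<close> would be even.\<close>

lemma rot_disjoint:
  assumes "\<And>u v z w. (u, v, z, w) \<in> A \<Longrightarrow> odd (u + v)"
  shows "rot ` A \<inter> rot_conj ` A = {}"
proof -
  have False if "(u, v, z, w) \<in> A" "(u', v', z', w') \<in> A"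
    and "rot (u, v, z, w) = rot_conj (u', v', z', w')" for u v z w u' v' z' w'
  proof -
    have "u + 3 * v = u' + 3 * v'" "v - u = u' - v'"
      using that(3) by (auto simp: rot_def rot_conj_def)
    with assms[OF that(1)] show False by presburger
  qed
  then show ?thesis by fastforce
qed

text \<open>The parity of the first coordinate separates the images: \<open>2 * u\<close> is even,
  while \<open>u + 3 * v\<close> has the parity of \<open>u + v\<close>.\<close>

lemma scale2_rot_disjoint:
  assumes "\<And>u v z w. (u, v, z, w) \<in> A \<Longrightarrow> odd (u + v)"
  shows "scale2 ` A \<inter> (rot ` A \<union> rot_conj ` A) = {}"
proof -
  have "even (fst q)" if "q \<in> scale2 ` A" for q
    using that by (auto simp: scale2_def)
  moreover have "odd (fst q)" if "q \<in> rot ` A \<union> rot_conj ` A" for q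
    using that assms by (fastforce simp: rot_def rot_conj_def)
  ultimately show ?thesis by blast
qed

lemma card_rot_union:
  assumes "finite A" "\<And>u v z w. (u, v, z, w) \<in> A \<Longrightarrow> odd (u + v)"
  shows "card (rot ` A \<union> rot_conj ` A) = 2 * card A"
  using assms rot_disjoint[of A]
  by (subst card_Un_disjoint) (auto simp: card_image inj_rot inj_rot_conj)

text \<open>If \<open>u + v\<close> were even, 4 would divide
  \<open>u\<^sup>2 + 3 * v\<^sup>2\<close>, leaving a sum of two squares congruent to -1 modulo 4.
  With \<open>u + v\<close> and \<open>k\<close> both odd, reduction modulo 2 then makes
  \<open>z + w\<close> even.\<close>

lemma sols_parity:
  fixes a c k :: int
  assumes "odd a" "odd c" "4 dvd k + c" and sol: "(u, v, z, w) \<in> diag_sols a (3 * a) c c k"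
  shows "odd (u + v) \<and> (even z \<longleftrightarrow> even w)"
proof -
  have k: "k = a * u\<^sup>2 + 3 * a * v\<^sup>2 + c * z\<^sup>2 + c * w\<^sup>2"
    using sol by simp
  have "odd (u + v)"
  proof
    assume "even (u + v)"
    then obtain r where "u + v = 2 * r" ..
    then have u: "u = 2 * r - v" by simp
    have "k + c = 4 * (a * (r\<^sup>2 - r * v + v\<^sup>2)) + c * (z\<^sup>2 + w\<^sup>2 + 1)"
      unfolding k u by (simp add: power2_eq_square algebra_simps)
    with assms(3) have "4 dvd c * (z\<^sup>2 + w\<^sup>2 + 1)"
      by (metis dvd_add_right_iff dvd_triv_left)
    moreover have "coprime 4 c"
      using assms(2) coprime_power_left_iff[of 2 2 c] by simp
    ultimately have "4 dvd z\<^sup>2 + w\<^sup>2 + 1"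
      using coprime_dvd_mult_right_iff by blast
    moreover have "x\<^sup>2 mod 4 \<in> {0, 1}" for x :: int
    proof (cases "even x")
      case True
      then obtain j where "x = 2 * j" ..
      then show ?thesis by (simp add: power2_eq_square)
    next
      case False
      then obtain j where "x = 2 * j + 1" by (rule oddE)
      then have "x\<^sup>2 = 1 + 4 * (j\<^sup>2 + j)" by (simp add: power2_eq_square algebra_simps)
      then have "x\<^sup>2 mod 4 = 1 mod 4" by (simp only: mod_mult_self2)
      then show ?thesis by simp
    qed
    moreover have False if "4 dvd s + t + 1" "s mod 4 \<in> {0, 1}" "t mod 4 \<in> {0, 1}" for s t :: int
      using that unfolding insert_iff empty_iff by presburger
    ultimately show False by blast
  qed
  moreover have "odd k" using assms(2,3) by presburger
  ultimately show ?thesis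
    unfolding k using assms(1,2) by auto
qed

theorem theorem2p3:
  fixes a m n :: nat
  assumes "a > 0" and "odd a" and "n > 0"
    and "[n = m + (a - 1) div 2] (mod 2)"
  shows "real (t_rep a (3 * a) (8 * m + 4) (8 * m + 4) n) =
      2 / 3 * real (N_rep a (3 * a) (8 * m + 4) (8 * m + 4) (8 * n + 16 * m + 4 * a + 8))
      - 2 * real (N_rep a (3 * a) (8 * m + 4) (8 * m + 4) (2 * n + 4 * m + a + 2))"
proof -
  define \<alpha> C K where "\<alpha> = int a" and "C = 2 * int m + 1" and "K = 2 * int n + 4 * int m + int a + 2"
  define S where "S = diag_sols \<alpha> (3 * \<alpha>) C C K"
  define So where "So = {(u, v, z, w) \<in> S. odd z \<and> odd w}"
  define Se where "Se = {(u, v, z, w) \<in> S. even z \<and> even w}"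
  define Q where "Q = diag_sols \<alpha> (3 * \<alpha>) (4 * C) (4 * C) (4 * K)"
  have "odd \<alpha>" "odd C" using assms by (auto simp: \<alpha>_def C_def)
  have "4 dvd K + C"
  proof -
    obtain j where j: "a = 2 * j + 1" using \<open>odd a\<close> by (rule oddE)
    then have "n mod 2 = (m + j) mod 2" using assms(4) by (simp add: cong_def)
    \<comment> \<open>This is \<open>K + C\<close>; modulo 4, \<open>2 * n\<close> may be replaced
      by \<open>2 * m + 2 * j\<close>, which gives \<open>8 * m + 4 * j + 4\<close>.\<close>
    then have "4 dvd 2 * n + 6 * m + (2 * j + 1) + 3" by presburger
    then have "int 4 dvd int (2 * n + 6 * m + (2 * j + 1) + 3)"
      using int_dvd_int_iff by blast
    then show ?thesis by (simp add: K_def C_def j algebra_simps)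
  qed
  have par: "odd (u + v) \<and> (even z \<longleftrightarrow> even w)" if "(u, v, z, w) \<in> S" for u v z w
    using sols_parity \<open>odd \<alpha>\<close> \<open>odd C\<close> \<open>4 dvd K + C\<close> that unfolding S_def by blast
  have "finite S"
    unfolding S_def using assms(1) by (intro finite_diag_sols) (auto simp: \<alpha>_def C_def)
  then have fin: "finite So" "finite Se"
    by (auto simp: So_def Se_def intro: rev_finite_subset)
  have Q: "Q = scale2 ` S \<union> (rot ` S \<union> rot_conj ` S)"
    unfolding Q_def S_def by (rule diag_sols_times_four) fact
  have "card Q = card S + 2 * card S"
    unfolding Q using \<open>finite S\<close> par scale2_rot_disjoint[of S] card_rot_union[of S]
    by (subst card_Un_disjoint) (auto simp: card_image inj_scale2)
  then have cQ: "card Q = 3 * card S" by simp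
  have "scale2 p \<notin> all_odd" for p
    by (cases p) (simp add: scale2_def)
  \<comment> \<open>On \<open>S\<close> the first two entries of both images are odd because
    \<open>u + v\<close> is, so only \<open>z\<close> and \<open>w\<close> decide.\<close>
  moreover have "rot p \<in> all_odd \<longleftrightarrow> p \<in> So" "rot_conj p \<in> all_odd \<longleftrightarrow> p \<in> So" if "p \<in> S" for p
    using that par by (cases p; fastforce simp: So_def rot_def rot_conj_def)+
  moreover have "So \<subseteq> S"
    by (auto simp: So_def)
  ultimately have "Q \<inter> all_odd = rot ` So \<union> rot_conj ` So"
    unfolding Q by blast
  moreover have "card (rot ` So \<union> rot_conj ` So) = 2 * card So"
    by (rule card_rot_union) (use fin par \<open>So \<subseteq> S\<close> in blast)+
  ultimately have cT: "card (Q \<inter> all_odd) = 2 * card So"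
    by simp
  have "S = So \<union> Se" "So \<inter> Se = {}"
    using par by (auto simp: So_def Se_def)
  then have cS: "card S = card So + card Se"
    using fin by (simp add: card_Un_disjoint)
  \<comment> \<open>Halving the even \<open>z\<close> and \<open>w\<close> turns the coefficient
    \<open>C\<close> into \<open>4 * C\<close> and keeps the value \<open>K\<close>.\<close>
  have "bij_betw (\<lambda>(u, v, z, w). (u, v, 2 * z, 2 * w)) (diag_sols \<alpha> (3 * \<alpha>) (4 * C) (4 * C) K) Se"
    by (rule bij_betw_byWitness[where f' = "\<lambda>(u, v, z, w). (u, v, z div 2, w div 2)"])
      (auto simp: Se_def S_def power2_eq_square elim!: evenE)
  then have cE: "card (diag_sols \<alpha> (3 * \<alpha>) (4 * C) (4 * C) K) = card Se"
    by (rule bij_betw_same_card)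
  have "t_rep a (3 * a) (8 * m + 4) (8 * m + 4) n = card (Q \<inter> all_odd)"
    unfolding t_rep_eq_card_odd_diag_sols Q_def
    by (simp add: \<alpha>_def C_def K_def algebra_simps)
  moreover have "N_rep a (3 * a) (8 * m + 4) (8 * m + 4) (8 * n + 16 * m + 4 * a + 8) = card Q"
    unfolding N_rep_eq_card_diag_sols Q_def
    by (simp add: \<alpha>_def C_def K_def algebra_simps)
  moreover have "N_rep a (3 * a) (8 * m + 4) (8 * m + 4) (2 * n + 4 * m + a + 2) = card Se"
    unfolding N_rep_eq_card_diag_sols cE[symmetric]
    by (simp add: \<alpha>_def C_def K_def algebra_simps)
  \<comment> \<open>With cardinalities written as bars, t = 2 |So| = 2 |S| - 2 |Se| and |S| = |Q| /
    3.\<close>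
  ultimately show ?thesis
    using cQ cT cS by (simp add: field_simps)
qed

end
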